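(* There exist closed sets $A\subseteq\mathbb{R}$ and $B\subseteq\mathbb{R}$, neither of which is $\sigma$-lower porous in $\mathbb{R}$, such that the Cartesian product $A\times B$ is lower porous in $\mathbb{R}^2$ (equipped with the maximum metric).
   Context: Let $(X,\rho)$ be a metric space; $B(x,r)$ denotes the open ball with centre $x$ and radius $r$. For $M\subseteq X$, $x\in X$, $R>0$ put $$\gamma(x,R,M)=\sup\{r>0:\ \text{for some } z\in X,\ B(z,r)\subseteq B(x,R)\setminus M\}$$ (with $\sup\emptyset=0$), and $\underline{p}(M,x)=\liminf_{R\to0_+}\frac{2\gamma(x,R,M)}{R}$. The set $M$ is lower porous at $x$ if $\underline{p}(M,x)>0$; $M$ is lower porous (in $X$) if it is lower porous at each of its points; $M$ is $\sigma$-lower porous (in $X$) if it is a countable union of lower porous sets. $\mathbb{R}$ carries the usual metric, and the maximum metric on a product of $(X,\rho)$ and $(Y,\sigma)$ is $\rho_m([x_1;y_1],[x_2;y_2])=\max\{\rho(x_1,x_2),\sigma(y_1,y_2)\}$, where $[x;y]$ denotes an ordered pair. *)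

theory Defs
  imports "HOL-Analysis.Analysis"
begin

text \<open>
  The library's metric on \<open>real \<times> real\<close> is the Euclidean one, so the notions are set up
  for an arbitrary metric space with explicit carrier \<open>M\<close> and metric \<open>d\<close>.
\<close>

context Metric_space
begin

text \<open>
  The supremum is taken in the extended nonnegative reals: there \<open>Sup {} = 0\<close>, and the value
  \<open>\<infinity>\<close> is admitted (it can occur when the whole space is a ball).
\<close>

definition hole_radius :: "'a \<Rightarrow> real \<Rightarrow> 'a set \<Rightarrow> ennreal" where
  "hole_radius x R S =
     Sup {ennreal r | r. r > 0 \<and> (\<exists>z\<in>M. mball z r \<subseteq> mball x R - S)}"

definition lower_porosity :: "'a set \<Rightarrow> 'a \<Rightarrow> ennreal" where
  "lower_porosity S x = Liminf (at_right (0::real)) (\<lambda>R. 2 * hole_radius x R S / ennreal R)"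

definition lower_porous_at :: "'a set \<Rightarrow> 'a \<Rightarrow> bool" where
  "lower_porous_at S x \<longleftrightarrow> lower_porosity S x > 0"

definition lower_porous :: "'a set \<Rightarrow> bool" where
  "lower_porous S \<longleftrightarrow> S \<subseteq> M \<and> (\<forall>x\<in>S. lower_porous_at S x)"

definition sigma_lower_porous :: "'a set \<Rightarrow> bool" where
  "sigma_lower_porous S \<longleftrightarrow>
     (\<exists>\<F>. countable \<F> \<and> (\<forall>N\<in>\<F>. lower_porous N) \<and> S = \<Union>\<F>)"

end

definition max_metric ::
  "('a \<Rightarrow> 'a \<Rightarrow> real) \<Rightarrow> ('b \<Rightarrow> 'b \<Rightarrow> real) \<Rightarrow> 'a \<times> 'b \<Rightarrow> 'a \<times> 'b \<Rightarrow> real" where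
  "max_metric d1 d2 p q = max (d1 (fst p) (fst q)) (d2 (snd p) (snd q))"

lemma Metric_space_max_metric:
  assumes "Metric_space M1 d1" and "Metric_space M2 d2"
  shows "Metric_space (M1 \<times> M2) (max_metric d1 d2)"
proof -
  interpret m1: Metric_space M1 d1 by fact
  interpret m2: Metric_space M2 d2 by fact
  show ?thesis
  proof
    fix x y
    show "0 \<le> max_metric d1 d2 x y"
      by (simp add: max_metric_def le_max_iff_disj)
    show "max_metric d1 d2 x y = max_metric d1 d2 y x"
      by (simp add: max_metric_def m1.commute m2.commute)
  next
    fix x y
    assume "x \<in> M1 \<times> M2" "y \<in> M1 \<times> M2"
    then have mem: "fst x \<in> M1" "snd x \<in> M2" "fst y \<in> M1" "snd y \<in> M2"
      by auto
    have "max_metric d1 d2 x y = 0 \<longleftrightarrow> d1 (fst x) (fst y) = 0 \<and> d2 (snd x) (snd y) = 0"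
      using m1.nonneg[of "fst x" "fst y"] m2.nonneg[of "snd x" "snd y"]
      unfolding max_metric_def max_def by (smt (verit))
    also have "\<dots> \<longleftrightarrow> x = y"
      using mem by (simp add: prod_eq_iff)
    finally show "max_metric d1 d2 x y = 0 \<longleftrightarrow> x = y" .
  next
    fix x y z
    assume "x \<in> M1 \<times> M2" "y \<in> M1 \<times> M2" "z \<in> M1 \<times> M2"
    then have "d1 (fst x) (fst z) \<le> d1 (fst x) (fst y) + d1 (fst y) (fst z)"
      and "d2 (snd x) (snd z) \<le> d2 (snd x) (snd y) + d2 (snd y) (snd z)"
      by (auto intro: m1.triangle m2.triangle)
    then show "max_metric d1 d2 x z \<le> max_metric d1 d2 x y + max_metric d1 d2 y z"
      by (auto simp: max_metric_def)
  qed
qed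

lemma Metric_space_real_plane_max:
  "Metric_space UNIV (max_metric (dist :: real \<Rightarrow> real \<Rightarrow> real) (dist :: real \<Rightarrow> real \<Rightarrow> real))"
  using Metric_space_max_metric[OF Met_TC.Metric_space_axioms Met_TC.Metric_space_axioms]
  by simp

end

theory Submission imports Defs begin

text \<open>
  Let \<open>A\<close> be the closure of the set of reals whose ternary digit at position \<open>n\<close> is never \<open>1\<close>
  for \<open>n \<in> S\<close>, and let \<open>B\<close> be defined in the same way from the complement of \<open>S\<close>, where both
  \<open>S\<close> and its complement contain arbitrarily long blocks of consecutive integers. At scale
  \<open>3 ^ (-n)\<close> one of \<open>A\<close>, \<open>B\<close> has a hole of comparable size near every point, and so has
  \<open>A \<times> B\<close>. If \<open>A\<close> were \<open>\<sigma>\<close>-lower porous, then by Baire's theorem some portion of it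
  would have holes of a fixed relative size at all small scales; but along a long block disjoint
  from \<open>S\<close>, the set \<open>A\<close> looks arbitrarily full in the middle of each of its ternary cells.
\<close>

section \<open>Lower porosity as holes at all small scales\<close>

text \<open>Only positivity of the liminf matters, so the factor 2 can be absorbed into
  \<open>c\<close>, and the extended-real supremum gives way to actual holes.\<close>

lemma (in Metric_space) lower_porous_at_iff:
  "lower_porous_at S x \<longleftrightarrow>
     (\<exists>c>0. \<forall>\<^sub>F R in at_right 0. \<exists>z\<in>M. \<exists>r>c * R. mball z r \<subseteq> mball x R - S)"
    (is "_ \<longleftrightarrow> (\<exists>c>0. eventually (?hole c) _)")
proof
  have pos: "\<forall>\<^sub>F R in at_right 0. R > (0::real)"
    by (simp add: eventually_at_right_less)
  {
    assume "lower_porous_at S x"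
    then obtain e where e: "0 < e" "e < lower_porosity S x"
      unfolding lower_porous_at_def using dense by blast
    then obtain b where b: "e = ennreal b" "b > 0"
      by (metis ennreal_cases ennreal_less_zero_iff infinity_ennreal_def not_less top_greatest)
    have "\<forall>\<^sub>F R in at_right 0. e < 2 * hole_radius x R S / ennreal R"
      using e(2) unfolding lower_porosity_def by (rule less_LiminfD)
    then have "eventually (?hole (b/2)) (at_right 0)"
      using pos
    proof eventually_elim
      case (elim R)
      have "ennreal (b * R) < 2 * hole_radius x R S"
      proof (rule ccontr)
        assume "\<not> ?thesis"
        then have "2 * hole_radius x R S / ennreal R \<le> ennreal (b * R) / ennreal R"
          by (intro divide_right_mono_ennreal) auto
        then show False
          using elim b by (simp add: divide_ennreal)
      qed
      moreover have "ennreal (b * R) = 2 * ennreal (b / 2 * R)"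
        using b elim by (simp add: ennreal_mult' [symmetric] flip: ennreal_numeral)
      ultimately have "ennreal (b / 2 * R) < hole_radius x R S"
        by (metis mult_left_mono not_less zero_le)
      then obtain r z where "ennreal (b / 2 * R) < ennreal r" "z \<in> M" "mball z r \<subseteq> mball x R - S"
        unfolding hole_radius_def less_Sup_iff by blast
      moreover have "b / 2 * R < r"
        using calculation(1) b elim by (simp add: ennreal_less_iff)
      ultimately show ?case
        by blast
    qed
    with b show "\<exists>c>0. eventually (?hole c) (at_right 0)"
      by (intro exI[of _ "b/2"]) simp
  next
    assume "\<exists>c>0. eventually (?hole c) (at_right 0)"
    then obtain c where c: "c > 0" "eventually (?hole c) (at_right 0)"
      by blast
    have "\<forall>\<^sub>F R in at_right 0. ennreal c \<le> 2 * hole_radius x R S / ennreal R"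
      using c(2) pos
    proof eventually_elim
      case (elim R)
      then obtain z r where zr: "z \<in> M" "r > c * R" "mball z r \<subseteq> mball x R - S"
        by blast
      have r: "r > 0"
        using zr(2) c elim by (smt (verit) mult_pos_pos)
      have "ennreal (c * R) \<le> ennreal r"
        using zr by (simp add: ennreal_leI)
      also have "\<dots> \<le> hole_radius x R S"
        unfolding hole_radius_def using zr r by (intro Sup_upper) auto
      also have "\<dots> \<le> 2 * hole_radius x R S"
        by (metis mult_2 le_iff_add)
      finally have "ennreal (c * R) / ennreal R \<le> 2 * hole_radius x R S / ennreal R"
        by (rule divide_right_mono_ennreal)
      then show ?case
        using c elim by (simp add: divide_ennreal)
    qed
    then have "ennreal c \<le> lower_porosity S x"
      unfolding lower_porosity_def by (rule Liminf_bounded)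
    then show "lower_porous_at S x"
      unfolding lower_porous_at_def using c by (smt (verit) ennreal_less_zero_iff less_le_trans)
  }
qed

section \<open>The Baire category argument\<close>

text \<open>
  The closure of a set with holes of relative size \<open>c\<close> at all scales
  below \<open>R\<^sub>0\<close> has such holes too, because a ball missing a set also misses its closure.
\<close>
lemma closed_sigma_lower_porous_imp_uniformly_porous_portion:
  fixes A :: "'a::{real_normed_vector,heine_borel} set"
  assumes "closed A" "A \<noteq> {}" "Metric_space.sigma_lower_porous UNIV dist A"
  obtains U c R0 where "open U" "A \<inter> U \<noteq> {}" "c > 0" "R0 > 0"
    "\<And>x R. x \<in> A \<Longrightarrow> 0 < R \<Longrightarrow> R < R0 \<Longrightarrow> ball x R \<subseteq> U
       \<Longrightarrow> \<exists>z r. r > c * R \<and> ball z r \<subseteq> ball x R - A"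
proof -
  obtain \<F> where \<F>: "countable \<F>" "\<And>N. N \<in> \<F> \<Longrightarrow> Met_TC.lower_porous N" "A = \<Union>\<F>"
    using assms(3) unfolding Met_TC.sigma_lower_porous_def by blast
  \<comment> \<open>The single index \<open>k\<close> bounds both the relative hole size and the
    range of scales, so countably many pieces \<open>P (N, k)\<close> cover
    \<open>A\<close>.\<close>
  define P :: "'a set \<times> nat \<Rightarrow> 'a set" where
    "P = (\<lambda>(N, k). {x \<in> N. \<forall>R. 0 < R \<longrightarrow> R < inverse (Suc k) \<longrightarrow>
       (\<exists>z r. r > inverse (Suc k) * R \<and> ball z r \<subseteq> ball x R - N)})"
  have cover: "\<exists>k. x \<in> P (N, k)" if "N \<in> \<F>" "x \<in> N" for N x
  proof -
    have "Met_TC.lower_porous_at N x"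
      using \<F>(2)[OF that(1)] that(2) unfolding Met_TC.lower_porous_def by blast
    then obtain c R1 where c: "c > 0" "R1 > 0"
      and h: "\<And>R. 0 < R \<Longrightarrow> R < R1 \<Longrightarrow> \<exists>z r. r > c * R \<and> ball z r \<subseteq> ball x R - N"
      unfolding Met_TC.lower_porous_at_iff eventually_at_right_field by auto
    obtain k where k: "inverse (Suc k) < min c R1"
      using reals_Archimedean[of "min c R1"] c by auto
    have "\<exists>z r. r > inverse (Suc k) * R \<and> ball z r \<subseteq> ball x R - N"
      if R: "0 < R" "R < inverse (Suc k)" for R
    proof -
      obtain z r where "r > c * R" "ball z r \<subseteq> ball x R - N"
        using h[of R] R k by auto
      moreover have "inverse (Suc k) * R \<le> c * R"
        using k R by (intro mult_right_mono) auto
      ultimately show ?thesis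
        by (meson le_less_trans)
    qed
    then show ?thesis
      using that(2) unfolding P_def by auto
  qed
  have "\<exists>i \<in> \<F> \<times> UNIV. \<exists>U. open U \<and> A \<inter> U \<noteq> {} \<and> A \<inter> U \<subseteq> closure (P i)"
  proof (rule ccontr)
    assume neg: "\<not> ?thesis"
    \<comment> \<open>If no \<open>closure (P i)\<close> contains a nonempty portion of
      \<open>A\<close>, these sets are relatively open and dense in \<open>A\<close>, yet have no
      common point.\<close>
    let ?G = "(\<lambda>i. A - closure (P i)) ` (\<F> \<times> UNIV)"
    have "A \<subseteq> closure (\<Inter>?G)"
    proof (rule Baire)
      show "closed A" "countable ?G"
        using assms \<F> by auto
      fix T assume "T \<in> ?G"
      then obtain i where i: "i \<in> \<F> \<times> UNIV" "T = A - closure (P i)"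
        by blast
      have "A \<inter> U \<inter> T \<noteq> {}" if "open U" "A \<inter> U \<noteq> {}" for U
        using neg i that by blast
      from this[of "- closure T"] have "A \<subseteq> closure T"
        using closure_subset[of T] by (auto simp: open_Compl)
      then show "openin (top_of_set A) T \<and> A \<subseteq> closure T"
        using i by (simp add: Diff_eq openin_open_Int open_Compl)
    qed
    moreover have "\<Inter>?G = {}"
    proof -
      have "\<exists>i\<in>\<F> \<times> UNIV. x \<in> closure (P i)" if "x \<in> A" for x
        using that cover \<F>(3) closure_subset by blast
      \<comment> \<open>An empty family would have intersection \<open>UNIV\<close>.\<close>
      moreover have "\<F> \<noteq> {}"
        using \<F>(3) assms(2) by blast
      ultimately show ?thesis
        by fastforce
    qed
    ultimately show False
      using assms(2) by simp
  qed
  then obtain N k U where U: "open U" "A \<inter> U \<noteq> {}" "A \<inter> U \<subseteq> closure (P (N, k))"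
    by auto
  define c where "c = inverse (real (Suc k))"
  have c: "c > 0"
    by (simp add: c_def)
  show ?thesis
  \<comment> \<open>The constant is halved because the hole is found in the ball of radius
    \<open>R / 2\<close> about a point \<open>y\<close> of \<open>P (N, k)\<close> near
    \<open>x\<close>.\<close>
  proof (rule that[of U "c / 2" "c"])
    fix x R
    assume x: "x \<in> A" and R: "0 < R" "R < c" "ball x R \<subseteq> U"
    then have "x \<in> closure (P (N, k))"
      using U(3) by (metis IntI centre_in_ball in_mono)
    then obtain y where y: "y \<in> P (N, k)" "dist y x < R / 2"
      using R unfolding closure_approachable by (meson half_gt_zero)
    have "\<forall>R. 0 < R \<longrightarrow> R < c \<longrightarrow> (\<exists>z r. r > c * R \<and> ball z r \<subseteq> ball y R - N)"
      using y(1) unfolding P_def c_def by blast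
    moreover have "0 < R / 2" "R / 2 < c"
      using R by auto
    ultimately obtain z r where zr: "r > c * (R / 2)" "ball z r \<subseteq> ball y (R / 2) - N"
      by blast
    have "ball y (R / 2) \<subseteq> ball x R"
    proof
      fix u assume "u \<in> ball y (R / 2)"
      then show "u \<in> ball x R"
        using y(2) dist_triangle3[of x u y] by simp
    qed
    moreover have "ball z r \<inter> closure (P (N, k)) = {}"
      using zr(2) by (subst open_Int_closure_eq_empty) (auto simp: P_def)
    ultimately have "ball z r \<subseteq> ball x R - A"
      using zr(2) R(3) U(3) by blast
    then show "\<exists>z r. r > c / 2 * R \<and> ball z r \<subseteq> ball x R - A"
      using zr(1) by (intro exI[of _ z] exI[of _ r]) simp
  qed (use U c in auto)
qed

section \<open>Sets with forbidden ternary digits\<close>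

text \<open>
  The floor forces a half-open choice of digits, so \<open>avoiding S\<close> need not be closed. In exchange,
  membership only depends on the \<open>3\<close>-adic cells \<open>[j / 3 ^ n, (j + 1) / 3 ^ n)\<close> containing the point.
\<close>
definition avoiding :: "nat set \<Rightarrow> real set" where
  "avoiding S = {x. \<forall>n\<in>S. \<lfloor>3 ^ n * x\<rfloor> mod 3 \<noteq> 1}"

lemma floor_mult_power_eq_div:
  fixes x :: real
  assumes "l \<le> n"
  shows "\<lfloor>3 ^ l * x\<rfloor> = \<lfloor>3 ^ n * x\<rfloor> div 3 ^ (n - l)"
proof -
  have "\<lfloor>3 ^ n * x / of_int (3 ^ (n - l))\<rfloor> = \<lfloor>3 ^ n * x\<rfloor> div 3 ^ (n - l)"
    by (rule floor_divide_real_eq_div) simp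
  moreover have "(3::real) ^ n = 3 ^ l * 3 ^ (n - l)"
    using assms by (simp flip: power_add)
  ultimately show ?thesis
    by simp
qed

lemma floor_mult_power_grid:
  fixes x :: real
  assumes "l \<le> n"
  shows "\<lfloor>3 ^ l * (of_int \<lfloor>3 ^ n * x\<rfloor> / 3 ^ n :: real)\<rfloor> = \<lfloor>3 ^ l * x\<rfloor>"
  unfolding floor_mult_power_eq_div[OF assms] by simp

text \<open>The digits of the truncated point agree with those of \<open>a\<close> up to position
  \<open>m\<close> and vanish after \<open>m + g\<close>; in between \<open>S\<close> imposes
  nothing. Hence the cell of \<open>a\<close> contains a full grid of points of
  \<open>avoiding S\<close>.\<close>

lemma grid_point_mem_avoiding:
  fixes a u :: real
  assumes a: "a \<in> avoiding S" and gap: "{m<..m + g} \<inter> S = {}"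
    and u: "\<lfloor>3 ^ m * u\<rfloor> = \<lfloor>3 ^ m * a\<rfloor>"
  shows "of_int \<lfloor>3 ^ (m + g) * u\<rfloor> / 3 ^ (m + g) \<in> avoiding S" (is "?y \<in> _")
  unfolding avoiding_def
proof (intro CollectI ballI)
  fix n assume n: "n \<in> S"
  consider "n \<le> m" | "m + g < n"
    using gap n by (meson disjoint_iff greaterThanAtMost_iff not_le)
  then show "\<lfloor>3 ^ n * ?y\<rfloor> mod 3 \<noteq> 1"
  proof cases
    case 1
    then have "\<lfloor>3 ^ n * ?y\<rfloor> = \<lfloor>3 ^ n * u\<rfloor>"
      by (intro floor_mult_power_grid) simp
    also have "\<dots> = \<lfloor>3 ^ n * a\<rfloor>"
      using u 1 by (simp add: floor_mult_power_eq_div[of n m])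
    finally have "\<lfloor>3 ^ n * ?y\<rfloor> = \<lfloor>3 ^ n * a\<rfloor>" .
    then show ?thesis
      using a n by (simp add: avoiding_def)
  next
    case 2
    \<comment> \<open>As \<open>n\<close> lies strictly beyond \<open>m + g\<close>, at least one
      factor 3 remains, which makes the digit 0.\<close>
    define q where "q = n - (m + g) - 1"
    have q: "n = m + g + Suc q"
      using 2 by (simp add: q_def)
    have "3 ^ n * ?y = of_int (3 * (3 ^ q * \<lfloor>3 ^ (m + g) * u\<rfloor>))"
      by (simp add: q power_add)
    then have "\<lfloor>3 ^ n * ?y\<rfloor> = 3 * (3 ^ q * \<lfloor>3 ^ (m + g) * u\<rfloor>)"
      by (metis floor_of_int)
    then show ?thesis
      by simp
  qed
qed

section \<open>Long gaps exclude sigma-lower porosity\<close>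

lemma not_sigma_lower_porous_closure_avoiding:
  assumes gaps: "\<And>m0 g. \<exists>m\<ge>m0. {m<..m + g} \<inter> S = {}"
  shows "\<not> Metric_space.sigma_lower_porous UNIV dist (closure (avoiding S))"
proof
  assume por: "Metric_space.sigma_lower_porous UNIV dist (closure (avoiding S))"
  have "0 \<in> avoiding S"
    by (simp add: avoiding_def)
  then have "closure (avoiding S) \<noteq> {}"
    by auto
  then obtain U c R0 where U: "open U" "closure (avoiding S) \<inter> U \<noteq> {}" and c: "c > 0" "R0 > 0"
    and hole: "\<And>x R. x \<in> closure (avoiding S) \<Longrightarrow> 0 < R \<Longrightarrow> R < R0 \<Longrightarrow> ball x R \<subseteq> U
       \<Longrightarrow> \<exists>z r. r > c * R \<and> ball z r \<subseteq> ball x R - closure (avoiding S)"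
    using closed_sigma_lower_porous_imp_uniformly_porous_portion[OF closed_closure _ por] by metis
  obtain a where a: "a \<in> avoiding S" "a \<in> U"
    using U open_Int_closure_eq_empty[OF U(1), of "avoiding S"] by blast
  obtain e where e: "e > 0" "ball a e \<subseteq> U"
    using U(1) a(2) open_contains_ball by blast
  \<comment> \<open>\<open>m0\<close> makes the cells small enough for \<open>U\<close> and
    \<open>R0\<close>; \<open>g\<close> makes the grid finer than the holes promised by
    \<open>c\<close>.\<close>
  obtain m0 where m0: "(1 / 3) ^ m0 < min e R0"
    using real_arch_pow_inv[of "min e R0" "1/3"] e c by auto
  obtain g where g: "(1 / 3) ^ g < c / 3"
    using real_arch_pow_inv[of "c / 3" "1/3"] c by auto
  \<comment> \<open>The extra level in \<open>Suc g\<close> makes \<open>x\<close>, a grid point of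
    level \<open>m + 1\<close>, admissible, and gives the grid mesh
    \<open>(1 / 3) ^ g * R\<close>.\<close>
  obtain m where m: "m \<ge> m0" "{m<..m + Suc g} \<inter> S = {}"
    using gaps by blast
  define j where "j = \<lfloor>3 ^ m * a\<rfloor>"
  \<comment> \<open>The ball about \<open>x\<close> of radius \<open>R\<close> is the open left two
    thirds of the level-\<open>m\<close> cell of \<open>a\<close>.\<close>
  define x where "x = (of_int j + 1 / 3) / (3 ^ m :: real)"
  define R where "R = 1 / (3 * 3 ^ m :: real)"
  have "(1 / 3) ^ m \<le> ((1 / 3) ^ m0 :: real)"
    using m(1) by (intro power_decreasing) auto
  then have small: "3 * R < min e R0"
    using m0 by (simp add: R_def power_one_over)
  have R: "R > 0" "R < R0"
    using small c by (auto simp: R_def)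
  have cell: "\<lfloor>3 ^ m * u\<rfloor> = \<lfloor>3 ^ m * a\<rfloor>" if "u \<in> ball x R" for u
  proof -
    have "x - R < u" "u < x + R"
      using that by (auto simp: dist_real_def)
    moreover have "3 ^ m * (x - R) = of_int j" "3 ^ m * (x + R) = of_int j + 2 / 3"
      by (simp_all add: x_def R_def field_simps)
    ultimately have "of_int j < 3 ^ m * u" "3 ^ m * u < of_int j + 2 / 3"
      by (metis mult_less_cancel_left_pos zero_less_numeral zero_less_power)+
    then show ?thesis
      unfolding j_def[symmetric] by (intro floor_unique) auto
  qed
  have "x \<in> avoiding S"
  proof -
    have "3 ^ (m + Suc g) * x = of_int (3 ^ g * (3 * j + 1))"
      by (simp add: x_def power_add field_simps)
    then have "of_int \<lfloor>3 ^ (m + Suc g) * x\<rfloor> / 3 ^ (m + Suc g) = x"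
      by (metis floor_of_int nonzero_mult_div_cancel_left power_not_zero zero_neq_numeral)
    then show ?thesis
      using grid_point_mem_avoiding[OF a(1) m(2) cell, of x] R by simp
  qed
  moreover have "ball x R \<subseteq> U"
  proof -
    have "of_int j \<le> 3 ^ m * a" "3 ^ m * a < of_int j + 1"
      unfolding j_def by linarith+
    then have "\<bar>of_int j + 1 / 3 - 3 ^ m * a\<bar> \<le> 2 / 3"
      by linarith
    then have "\<bar>3 ^ m * (x - a)\<bar> \<le> 2 / 3"
      by (simp add: x_def right_diff_distrib)
    then have "\<bar>x - a\<bar> \<le> 2 * R"
      unfolding abs_mult R_def by (simp add: field_simps)
    then have "ball x R \<subseteq> ball a e"
      using small by (auto simp: dist_real_def)
    then show ?thesis
      using e by blast
  qed
  ultimately obtain z r where zr: "r > c * R" "ball z r \<subseteq> ball x R - closure (avoiding S)"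
    using hole[of x R] R closure_subset by blast
  \<comment> \<open>The centre of the hole lies in the same cell, so truncating it gives a point of
    \<open>avoiding S\<close> inside the hole.\<close>
  have "z \<in> ball x R"
    using zr c R by (metis Diff_iff centre_in_ball less_trans mult_pos_pos subset_iff)
  then have y: "of_int \<lfloor>3 ^ (m + Suc g) * z\<rfloor> / 3 ^ (m + Suc g) \<in> avoiding S" (is "?y \<in> _")
    using grid_point_mem_avoiding[OF a(1) m(2) cell] by blast
  have "\<bar>3 ^ (m + Suc g) * z - of_int \<lfloor>3 ^ (m + Suc g) * z\<rfloor>\<bar> \<le> 1"
    by linarith
  then have "\<bar>3 ^ (m + Suc g) * (z - ?y)\<bar> \<le> 1"
    by (simp add: right_diff_distrib)
  then have "\<bar>z - ?y\<bar> \<le> (1 / 3) ^ g * R"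
    by (simp add: abs_mult R_def field_simps power_add)
  also have "\<dots> < c * R"
    using g R c by simp
  finally have "?y \<in> ball z r"
    using zr by (simp add: dist_real_def)
  then show False
    using y zr closure_subset by blast
qed

section \<open>Holes in the factors and in the product\<close>

lemma hole_closure_avoiding:
  assumes "n \<in> S"
  obtains z where "\<bar>z - x\<bar> \<le> (3 / 2) / 3 ^ n" "ball z ((1 / 2) / 3 ^ n) \<inter> closure (avoiding S) = {}"
proof -
  define k where "k = \<lfloor>3 ^ n * x\<rfloor>"
  \<comment> \<open>Cells are grouped in triples by index modulo 3; \<open>j\<close> is the middle
    one of the triple of \<open>k\<close>, and \<open>z\<close> is the centre of that forbidden
    cell.\<close>
  define j where "j = k - k mod 3 + 1"
  define z where "z = (of_int j + 1 / 2) / (3 ^ n :: real)"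
  have j: "j mod 3 = 1" "\<bar>j - k\<bar> \<le> 1"
    unfolding j_def by presburger+
  have "\<bar>3 ^ n * (z - x)\<bar> \<le> 3 / 2"
  proof -
    have "of_int k \<le> 3 ^ n * x" "3 ^ n * x < of_int k + 1"
      unfolding k_def by linarith+
    moreover have "\<bar>real_of_int j - of_int k\<bar> \<le> 1"
      using j(2) by linarith
    ultimately have "\<bar>of_int j + 1 / 2 - 3 ^ n * x\<bar> \<le> 3 / 2"
      by linarith
    then show ?thesis
      by (simp add: z_def right_diff_distrib)
  qed
  then have 1: "\<bar>z - x\<bar> \<le> (3 / 2) / 3 ^ n"
    unfolding abs_mult by (simp add: field_simps)
  have "u \<notin> avoiding S" if "u \<in> ball z ((1 / 2) / 3 ^ n)" for u
  proof -
    have "\<bar>3 ^ n * (z - u)\<bar> < 1 / 2"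
      using that unfolding abs_mult by (simp add: dist_real_def field_simps)
    then have "\<lfloor>3 ^ n * u\<rfloor> = j"
      unfolding abs_less_iff by (intro floor_unique) (auto simp: z_def right_diff_distrib)
    then show ?thesis
      using j assms by (auto simp: avoiding_def)
  qed
  then have "ball z ((1 / 2) / 3 ^ n) \<inter> closure (avoiding S) = {}"
    by (subst open_Int_closure_eq_empty) auto
  with 1 show ?thesis
    by (rule that)
qed

text \<open>Balls of the maximum metric are squares, so a hole in one factor, times any interval of
  the same length, is a hole in the product. Every scale \<open>n\<close> belongs to
  \<open>S\<close> or \<open>T\<close>, so one factor always supplies it.\<close>

lemma lower_porous_Times_closure_avoiding:
  assumes "S \<union> T = UNIV"
  shows "Metric_space.lower_porous UNIV (max_metric dist dist)
    (closure (avoiding S) \<times> closure (avoiding T))"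
proof -
  interpret plane: Metric_space UNIV "max_metric (dist :: real \<Rightarrow> _) (dist :: real \<Rightarrow> real \<Rightarrow> real)"
    by (rule Metric_space_real_plane_max)
  have mball: "plane.mball p r = ball (fst p) r \<times> ball (snd p) r" for p r
    by (auto simp: plane.mball_def max_metric_def)
  have "\<exists>q r. r > 1 / 13 * R \<and>
      plane.mball q r \<subseteq> plane.mball p R - closure (avoiding S) \<times> closure (avoiding T)"
    if R: "0 < R" "R < 1" for p R
  proof -
    obtain x y where p: "p = (x, y)"
      by (cases p)
    \<comment> \<open>The hole reaches at most \<open>3 / 2 + 1 / 2 = 2\<close> cell lengths from
      the point, so \<open>n\<close> is the first level at which it fits into radius
      \<open>R\<close>. Minimality gives \<open>R \<le> 12 * r\<close> below, whence the strict
      bound with \<open>1 / 13\<close>.\<close>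
    define n where "n = (LEAST n. 2 * (1 / 3) ^ n < R)"
    have ex: "\<exists>n. 2 * (1 / 3) ^ n < R"
      using real_arch_pow_inv[of "R / 2" "1 / 3"] R by (auto simp: field_simps)
    then have n: "2 * (1 / 3) ^ n < R"
      unfolding n_def by (rule LeastI_ex)
    then have "n \<noteq> 0"
      using R by (intro notI) simp
    then obtain l where l: "n = Suc l"
      using not0_implies_Suc by blast
    then have "\<not> 2 * (1 / 3) ^ l < R"
      unfolding n_def by (metis lessI not_less_Least)
    then have big: "R \<le> 6 * (1 / 3) ^ n"
      by (simp add: l)
    define r where "r = (1 / 2) / (3 ^ n :: real)"
    have r: "r > 1 / 13 * R" "4 * r < R" "r > 0"
      using big n R by (auto simp: r_def power_one_over)
    have sub: "ball w r \<subseteq> ball v R" if "\<bar>w - v\<bar> \<le> (3 / 2) / 3 ^ n" for v w :: real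
      using that r by (auto simp: dist_real_def r_def)
    show ?thesis
    proof (cases "n \<in> S")
      case True
      then obtain z where z: "\<bar>z - x\<bar> \<le> (3 / 2) / 3 ^ n" "ball z r \<inter> closure (avoiding S) = {}"
        using hole_closure_avoiding unfolding r_def by blast
      then have "plane.mball (z, y) r \<subseteq> plane.mball p R - closure (avoiding S) \<times> closure (avoiding T)"
        using sub[OF z(1)] sub[of y y] unfolding mball p by auto
      then show ?thesis
        using r by blast
    next
      case False
      then have "n \<in> T"
        using assms by blast
      then obtain z where z: "\<bar>z - y\<bar> \<le> (3 / 2) / 3 ^ n" "ball z r \<inter> closure (avoiding T) = {}"
        using hole_closure_avoiding unfolding r_def by blast
      then have "plane.mball (x, z) r \<subseteq> plane.mball p R - closure (avoiding S) \<times> closure (avoiding T)"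
        using sub[OF z(1)] sub[of x x] unfolding mball p by auto
      then show ?thesis
        using r by blast
    qed
  qed
  then have "plane.lower_porous_at (closure (avoiding S) \<times> closure (avoiding T)) p" for p
    unfolding plane.lower_porous_at_iff eventually_at_right_field
    by (intro exI[of _ "1 / 13"] conjI exI[of _ 1]) auto
  then show ?thesis
    by (simp add: plane.lower_porous_def)
qed

section \<open>Choice of the digit positions\<close>

text \<open>The integer part of the square root is constant from \<open>k\<^sup>2\<close> up to just
  before \<open>(k + 1)\<^sup>2\<close>, a block whose length grows with \<open>k\<close>; its
  parity can be chosen to exclude the block from the set.\<close>

lemma gaps_parity_sqrt:
  fixes m0 g :: nat
  shows "\<exists>m\<ge>m0. {m<..m + g} \<inter> {n :: nat. even (nat \<lfloor>sqrt n\<rfloor>) = b} = {}"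
proof -
  define k where "k = 2 * (m0 + g) + (if b then 1 else 0)"
  have "nat \<lfloor>sqrt n\<rfloor> = k" if "n \<in> {k\<^sup>2<..k\<^sup>2 + g}" for n
  proof -
    have "g \<le> k"
      by (simp add: k_def)
    then have "n < (k + 1)\<^sup>2"
      using that by (simp add: power2_eq_square)
    then have "real n < (real k + 1)\<^sup>2"
      by (metis of_nat_1 of_nat_add of_nat_less_iff of_nat_power)
    then have "sqrt n < real k + 1"
      by (intro real_less_lsqrt) auto
    moreover have "real k \<le> sqrt n"
      using that by (intro real_le_rsqrt) (metis greaterThanAtMost_iff less_imp_le of_nat_le_iff of_nat_power)
    ultimately have "\<lfloor>sqrt n\<rfloor> = int k"
      by (intro floor_unique) auto
    then show ?thesis
      by simp
  qed
  moreover have "even k \<noteq> b"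
    by (simp add: k_def)
  moreover have "k\<^sup>2 \<ge> m0"
    unfolding power2_eq_square by (rule order_trans[OF _ le_square]) (simp add: k_def)
  ultimately show ?thesis
    by (intro exI[of _ "k\<^sup>2"]) auto
qed

theorem theorem1:
  "\<exists>(A :: real set) (B :: real set). closed A \<and> closed B
     \<and> \<not> Metric_space.sigma_lower_porous UNIV dist A
     \<and> \<not> Metric_space.sigma_lower_porous UNIV dist B
     \<and> Metric_space.lower_porous UNIV (max_metric dist dist) (A \<times> B)"
proof -
  \<comment> \<open>The two parities give complementary sets, both with arbitrarily long
    gaps.\<close>
  define S :: "bool \<Rightarrow> nat set" where "S b = {n. even (nat \<lfloor>sqrt n\<rfloor>) = b}" for b
  have "\<not> Metric_space.sigma_lower_porous UNIV dist (closure (avoiding (S b)))" for b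
    unfolding S_def by (intro not_sigma_lower_porous_closure_avoiding gaps_parity_sqrt)
  moreover have "S True \<union> S False = UNIV"
    by (auto simp: S_def)
  ultimately show ?thesis
    using lower_porous_Times_closure_avoiding closed_closure by blast
qed

end
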